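(* Let $\rho>0$, $\rho\neq1$, and let $h$ be holomorphic on $\Omega(\rho)$. Then for all $q\in\mathbb{N}^+\cup\{\infty\}$ and all $z\in\Omega(\rho)$, $$h(z)=\sum_{r=0}^{\infty}a_{r,q}(h)X_{r,q}(z),\qquad a_{r,q}(h)=\frac{1}{2\pi i}\oint_{|\xi|=1} h(\xi+\xi^{-1})\,\xi^{r-1}\frac{1-\xi^2}{1-q^{-1}\xi^2}\,d\xi,$$ and the series converges absolutely and uniformly on every compact subset of $\Omega(\rho)$.
   Context: For $q\in\mathbb{N}^+\cup\{\infty\}$, with the convention $1/\infty=0$, the polynomials $X_{r,q}$ ($r\in\mathbb{N}$) are defined by the Taylor expansion at $t=0$: $\frac{1-q^{-1}t^2}{1-xt+t^2}=\sum_{r\ge0}X_{r,q}(x)t^r$. For $\rho>0,\rho\ne1$: $\Omega(\rho)=\{w\in\mathbb{C}: \frac{(\mathrm{Re}\,w)^2}{(\rho+\rho^{-1})^2}+\frac{(\mathrm{Im}\,w)^2}{(\rho-\rho^{-1})^2}<1\}$ (the image under $\xi\mapsto\xi+\xi^{-1}$ of the annulus between radii $\rho$ and $\rho^{-1}$, which contains $[-2,2]$). *)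

theory Defs
  imports "HOL-Complex_Analysis.Complex_Analysis" "HOL-Library.Extended_Nat"
begin

text \<open>The inverse of a parameter in the positive naturals extended by infinity,
  with the convention that the inverse of infinity is 0.\<close>

definition qinv :: "enat \<Rightarrow> complex" where
  "qinv q = (case q of enat n \<Rightarrow> 1 / of_nat n | \<infinity> \<Rightarrow> 0)"

text \<open>The library's \<^const>\<open>fps_expansion\<close> is the Taylor series of a function at a point;
  here it is taken in \<open>t\<close> at 0, for fixed \<open>x\<close>.\<close>

definition Xpol :: "nat \<Rightarrow> enat \<Rightarrow> complex \<Rightarrow> complex" where
  "Xpol r q x = fps_nth (fps_expansion (\<lambda>t. (1 - qinv q * t\<^sup>2) / (1 - x * t + t\<^sup>2)) 0) r"

definition Omega :: "real \<Rightarrow> complex set" where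
  "Omega \<rho> = {w. (Re w)\<^sup>2 / (\<rho> + inverse \<rho>)\<^sup>2 + (Im w)\<^sup>2 / (\<rho> - inverse \<rho>)\<^sup>2 < 1}"

text \<open>The exponent \<open>r - 1\<close> is \<open>-1\<close> for \<open>r = 0\<close>, hence the integer power. For \<open>q = 1\<close> the
  quotient has removable singularities at \<open>\<xi> = 1\<close> and \<open>\<xi> = -1\<close>; its value there
  (0, as division by 0 yields 0) does not affect the integral.\<close>

definition coeff_a :: "nat \<Rightarrow> enat \<Rightarrow> (complex \<Rightarrow> complex) \<Rightarrow> complex" where
  "coeff_a r q h = 1 / (2 * of_real pi * \<i>) *
     contour_integral (circlepath 0 1)
       (\<lambda>\<xi>. h (\<xi> + inverse \<xi>) * \<xi> powi (int r - 1) * ((1 - \<xi>\<^sup>2) / (1 - qinv q * \<xi>\<^sup>2)))"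

lemma Xpol_gen:
  "fps_expansion (\<lambda>t. (1 - qinv q * t\<^sup>2) / (1 - x * t + t\<^sup>2)) 0 =
     (1 - fps_const (qinv q) * fps_X ^ 2) / (1 - fps_const x * fps_X + fps_X ^ 2)"
proof -
  have "(\<lambda>t. (1 - qinv q * t\<^sup>2) / (1 - x * t + t\<^sup>2)) has_fps_expansion
     (1 - fps_const (qinv q) * fps_X ^ 2) / (1 - fps_const x * fps_X + fps_X ^ 2)"
    by (rule has_fps_expansion_divide') (auto intro!: fps_expansion_intros)
  from fps_nth_fps_expansion[OF this] show ?thesis
    by (simp add: fps_eq_iff fps_expansion_def)
qed

lemma Xpol_rec:
  "Xpol 0 q x = 1"
  "Xpol (Suc 0) q x = x"
  "Xpol (Suc (Suc r)) q x =
     x * Xpol (Suc r) q x - Xpol r q x - (if r = 0 then qinv q else 0)"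
proof -
  define F where "F = fps_expansion (\<lambda>t. (1 - qinv q * t\<^sup>2) / (1 - x * t + t\<^sup>2)) 0"
  have "fps_nth (1 - fps_const x * fps_X + fps_X ^ 2) 0 \<noteq> 0" by simp
  then have "is_unit (1 - fps_const x * fps_X + fps_X ^ 2)"
    by (simp add: fps_is_unit_iff)
  then have eq: "F * (1 - fps_const x * fps_X + fps_X ^ 2) = 1 - fps_const (qinv q) * fps_X ^ 2"
    unfolding F_def Xpol_gen by (rule dvd_div_mult_self[OF unit_imp_dvd])
  have eq': "F = 1 - fps_const (qinv q) * fps_X ^ 2 + fps_const x * (fps_X * F) - fps_X ^ 2 * F"
    unfolding eq[symmetric] by (simp add: algebra_simps)
  have n: "fps_nth F n = fps_nth (1 - fps_const (qinv q) * fps_X ^ 2 + fps_const x * (fps_X * F)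
      - fps_X ^ 2 * F) n" for n
    by (rule arg_cong[OF eq'])
  have X: "Xpol r q x = fps_nth F r" for r by (simp add: Xpol_def F_def)
  show 0: "Xpol 0 q x = 1" unfolding X by (subst n) (simp add: fps_X_power_mult_nth)
  show "Xpol (Suc 0) q x = x"
    unfolding X by (subst n) (use 0 in \<open>simp add: X fps_X_power_mult_nth fps_X_power_nth\<close>)
  show "Xpol (Suc (Suc r)) q x =
     x * Xpol (Suc r) q x - Xpol r q x - (if r = 0 then qinv q else 0)"
    unfolding X by (subst n) (simp add: fps_X_power_mult_nth fps_X_power_nth)
qed

lemma Xpol_polynomial: "\<exists>p :: complex poly. \<forall>x. Xpol r q x = poly p x"
proof (induction r rule: less_induct)
  case (less r)
  show ?case
  proof (cases r)
    case 0
    then show ?thesis by (intro exI[of _ 1]) (simp add: Xpol_rec)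
  next
    case (Suc r')
    show ?thesis
    proof (cases r')
      case 0
      with Suc show ?thesis by (intro exI[of _ "[:0, 1:]"]) (simp add: Xpol_rec)
    next
      case (Suc s)
      with \<open>r = Suc r'\<close> have r: "r = Suc (Suc s)" by simp
      from less[of "Suc s"] obtain p1 where "\<forall>x. Xpol (Suc s) q x = poly p1 x" using r by auto
      moreover from less[of s] obtain p0 where "\<forall>x. Xpol s q x = poly p0 x" using r by auto
      ultimately show ?thesis unfolding r
        by (intro exI[of _ "[:0, 1:] * p1 - p0 - [:if s = 0 then qinv q else 0:]"])
           (simp add: Xpol_rec)
    qed
  qed
qed

end

theory Submission
  imports Defs
begin

text \<open>
  Since \<open>\<Omega>(\<rho>) = \<Omega>(1/\<rho>)\<close> we may take \<open>\<rho> < 1\<close>. Write \<open>z = \<zeta> + 1/\<zeta>\<close> with \<open>\<rho> < |\<zeta>| \<le> 1\<close>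
  and choose \<open>\<rho> < s < |\<zeta>|\<close>. Cauchy's formula on the ellipse that is the image of \<open>|\<xi>| = s\<close>
  under \<open>\<xi> \<mapsto> \<xi> + 1/\<xi>\<close> (traversed clockwise, as \<open>s < 1\<close>) expresses \<open>h(z)\<close> as an integral over
  \<open>|\<xi>| = s\<close> with kernel \<open>\<xi>\<^sup>-\<^sup>1(1 - \<xi>\<^sup>2)/(1 - z\<xi> + \<xi>\<^sup>2)\<close>. Expanding the kernel by the
  generating function of the \<open>X\<^sub>r\<^sub>,\<^sub>q\<close> and integrating termwise gives the series, because the circle
  of integration in \<open>a\<^sub>r\<^sub>,\<^sub>q\<close> may be shrunk from 1 to \<open>s\<close>. The estimates \<open>|a\<^sub>r\<^sub>,\<^sub>q| = O(s\<^sup>r)\<close> and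
  \<open>|X\<^sub>r\<^sub>,\<^sub>q(z)| \<le> 2(r+1)|\<zeta>|\<^sup>-\<^sup>r\<close> give the convergence, uniformly on compact sets because \<open>|\<zeta>|\<close>
  stays above some \<open>m > \<rho>\<close> there.
\<close>

section \<open>Geometry of the ellipse and of the Joukowski map\<close>

lemma Omega_inverse: "Omega (inverse \<rho>) = Omega \<rho>"
  by (simp add: Omega_def add.commute power2_commute[of "inverse \<rho>" \<rho>])

text \<open>Rescaling the two axes is real-linear and turns the ellipse into the unit disc, from
  which openness and convexity are pulled back.\<close>

lemma Omega_eq_vimage_ball:
  "Omega \<rho> = (\<lambda>w. Complex (Re w / (\<rho> + inverse \<rho>)) (Im w / (\<rho> - inverse \<rho>))) -` ball 0 1"
  by (auto simp: Omega_def cmod_def power_divide)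

lemma open_Omega: "open (Omega \<rho>)"
  unfolding Omega_eq_vimage_ball
  by (intro open_vimage) (auto simp: Complex_eq divide_inverse intro!: continuous_intros)

lemma convex_Omega: "convex (Omega \<rho>)"
  unfolding Omega_eq_vimage_ball
  by (intro convex_linear_vimage linearI)
    (auto simp: complex_eq_iff add_divide_distrib)

text \<open>In polar form the weights are the squared cosine and sine of the argument. They sum to
  1, so membership reduces to comparing the two squared ratios of semi-axes with 1.\<close>

lemma Omega_joukowski_iff:
  assumes "\<zeta> \<noteq> 0"
  defines "s \<equiv> norm \<zeta>"
  shows "\<zeta> + inverse \<zeta> \<in> Omega \<rho> \<longleftrightarrow>
    (Re \<zeta> / s)\<^sup>2 * ((s + inverse s) / (\<rho> + inverse \<rho>))\<^sup>2 +
    (Im \<zeta> / s)\<^sup>2 * ((s - inverse s) / (\<rho> - inverse \<rho>))\<^sup>2 < 1"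
proof -
  have s: "s > 0" "s\<^sup>2 = (Re \<zeta>)\<^sup>2 + (Im \<zeta>)\<^sup>2"
    using assms by (auto simp: cmod_power2)
  have "Re (inverse \<zeta>) = Re \<zeta> / s\<^sup>2" "Im (inverse \<zeta>) = - Im \<zeta> / s\<^sup>2"
    by (simp_all add: s(2))
  then have "Re (\<zeta> + inverse \<zeta>) = Re \<zeta> / s * (s + inverse s)"
    and "Im (\<zeta> + inverse \<zeta>) = Im \<zeta> / s * (s - inverse s)"
    using s(1) by (simp_all del: inverse_complex.sel add: field_simps power2_eq_square)
  then show ?thesis
    by (simp add: Omega_def power_mult_distrib power_divide)
qed

lemma sum_squares_unit: "\<zeta> \<noteq> 0 \<Longrightarrow> (Re \<zeta> / norm \<zeta>)\<^sup>2 + (Im \<zeta> / norm \<zeta>)\<^sup>2 = 1"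
  by (simp add: power_divide cmod_power2[symmetric] flip: add_divide_distrib)

text \<open>A circle inside the annulus goes to an ellipse with both semi-axes strictly smaller than
  those of \<open>Omega \<rho>\<close>; a convex combination of numbers below 1 is below 1.\<close>

lemma joukowski_in_Omega:
  assumes "0 < \<rho>" "\<rho> < 1" "\<rho> < norm \<zeta>" "norm \<zeta> < inverse \<rho>"
  shows "\<zeta> + inverse \<zeta> \<in> Omega \<rho>"
proof -
  define s where "s = norm \<zeta>"
  have s: "0 < s" "\<rho> < s" "s < inverse \<rho>" and \<zeta>: "\<zeta> \<noteq> 0"
    using assms by (auto simp: s_def)
  have "inverse s < inverse \<rho>" "\<rho> < inverse s"
    using s assms(1) less_imp_inverse_less[of \<rho> s] less_imp_inverse_less[of s "inverse \<rho>"] by auto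
  have "(s + inverse s) < \<rho> + inverse \<rho>"
  proof -
    \<comment> \<open>The second factor is positive since \<open>\<rho> * s < 1\<close>, which holds
      also for \<open>s > 1\<close> because \<open>s < inverse \<rho>\<close>.\<close>
    have "\<rho> + inverse \<rho> - (s + inverse s) = (s - \<rho>) * (inverse (\<rho> * s) - 1)"
      using s assms(1) by (simp add: field_simps)
    moreover have "1 < inverse (\<rho> * s)"
      using s assms(1) by (simp add: field_simps)
    ultimately show ?thesis
      using s mult_pos_pos[of "s - \<rho>" "inverse (\<rho> * s) - 1"] by linarith
  qed
  then have A: "((s + inverse s) / (\<rho> + inverse \<rho>))\<^sup>2 < 1"
    using s assms(1) by (simp add: abs_square_less_1 add_pos_pos)
  have "\<bar>s - inverse s\<bar> < \<bar>\<rho> - inverse \<rho>\<bar>"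
    using \<open>inverse s < inverse \<rho>\<close> \<open>\<rho> < inverse s\<close> s by linarith
  then have B: "((s - inverse s) / (\<rho> - inverse \<rho>))\<^sup>2 < 1"
    by (simp add: abs_square_less_1)
  have "(Re \<zeta> / s)\<^sup>2 * ((s + inverse s) / (\<rho> + inverse \<rho>))\<^sup>2 +
    (Im \<zeta> / s)\<^sup>2 * ((s - inverse s) / (\<rho> - inverse \<rho>))\<^sup>2 < 1"
    by (rule convex_bound_lt[OF A B]) (use sum_squares_unit[OF \<zeta>] in \<open>auto simp: s_def\<close>)
  then show ?thesis using Omega_joukowski_iff[OF \<zeta>] by (simp add: s_def)
qed

text \<open>The reverse comparison: both squared ratios are at least 1, hence so is their weighted
  mean.\<close>

lemma joukowski_notin_Omega:
  assumes "0 < \<rho>" "\<rho> < 1" "\<zeta> \<noteq> 0" "norm \<zeta> \<le> \<rho>"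
  shows "\<zeta> + inverse \<zeta> \<notin> Omega \<rho>"
proof -
  define s where "s = norm \<zeta>"
  have s: "0 < s" "s \<le> \<rho>"
    using assms by (auto simp: s_def)
  have inv: "inverse \<rho> \<le> inverse s" "1 < inverse \<rho>"
    using s assms by (auto intro: le_imp_inverse_le one_less_inverse)
  have "\<rho> + inverse \<rho> \<le> s + inverse s"
  proof -
    have "\<rho> * s < 1" using s assms by (smt (verit) mult_le_one mult_less_cancel_left2)
    have "s + inverse s - (\<rho> + inverse \<rho>) = (\<rho> - s) * (inverse (\<rho> * s) - 1)"
      using s assms(1) by (simp add: field_simps)
    moreover have "1 < inverse (\<rho> * s)"
      using s assms(1) \<open>\<rho> * s < 1\<close> by (intro one_less_inverse) auto
    ultimately show ?thesis
      using s mult_nonneg_nonneg[of "\<rho> - s" "inverse (\<rho> * s) - 1"] by linarith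
  qed
  then have A: "1 \<le> ((s + inverse s) / (\<rho> + inverse \<rho>))\<^sup>2"
    using s assms(1) by (intro one_le_power) (simp add: add_pos_pos)
  have "\<bar>\<rho> - inverse \<rho>\<bar> \<le> \<bar>s - inverse s\<bar>" "\<rho> - inverse \<rho> \<noteq> 0"
    using inv s assms by linarith+
  then have "1 \<le> \<bar>(s - inverse s) / (\<rho> - inverse \<rho>)\<bar>"
    by (simp add: abs_divide)
  from one_le_power[OF this, of 2] have B: "1 \<le> ((s - inverse s) / (\<rho> - inverse \<rho>))\<^sup>2"
    unfolding power2_abs .
  have "1 = (Re \<zeta> / s)\<^sup>2 * 1 + (Im \<zeta> / s)\<^sup>2 * 1"
    using sum_squares_unit[OF assms(3)] by (simp add: s_def)
  also have "\<dots> \<le> (Re \<zeta> / s)\<^sup>2 * ((s + inverse s) / (\<rho> + inverse \<rho>))\<^sup>2 +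
    (Im \<zeta> / s)\<^sup>2 * ((s - inverse s) / (\<rho> - inverse \<rho>))\<^sup>2"
    by (intro add_mono mult_left_mono A B) auto
  finally show ?thesis using Omega_joukowski_iff[OF assms(3)] by (simp add: s_def)
qed

text \<open>The roots of \<open>\<zeta>\<^sup>2 - z * \<zeta> + 1\<close> are reciprocal to each
  other, so one of them lies in the closed unit disc.\<close>

lemma obtain_joukowski_preimage:
  fixes z :: complex
  obtains \<zeta> where "\<zeta> \<noteq> 0" "norm \<zeta> \<le> 1" "z = \<zeta> + inverse \<zeta>"
proof -
  define \<zeta> where "\<zeta> = (z + csqrt (z\<^sup>2 - 4)) / 2"
  have "\<zeta> * (z - \<zeta>) = (z\<^sup>2 - (csqrt (z\<^sup>2 - 4))\<^sup>2) / 4"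
    by (simp add: \<zeta>_def field_simps power2_eq_square)
  then have eq: "\<zeta> * (z - \<zeta>) = 1" by simp
  then have \<zeta>: "\<zeta> \<noteq> 0" "z = \<zeta> + inverse \<zeta>"
    using inverse_unique[OF eq] by auto
  show thesis
  proof (cases "norm \<zeta> \<le> 1")
    case False
    then show thesis using \<zeta> that[of "inverse \<zeta>"]
      by (auto simp: norm_inverse inverse_le_1_iff)
  qed (use \<zeta> that in auto)
qed

text \<open>Here \<open>m\<close> is the least modulus of a preimage in the closed annulus:
  compactness makes it attained, and \<open>joukowski_notin_Omega\<close> makes it exceed
  \<open>\<rho>\<close>.\<close>

lemma compact_joukowski_bound:
  assumes "0 < \<rho>" "\<rho> < 1" "compact K" "K \<subseteq> Omega \<rho>"
  obtains m where "\<rho> < m" "m \<le> 1"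
    "\<And>\<zeta>. \<zeta> \<noteq> 0 \<Longrightarrow> norm \<zeta> \<le> 1 \<Longrightarrow> \<zeta> + inverse \<zeta> \<in> K \<Longrightarrow> m \<le> norm \<zeta>"
proof -
  define A where "A = {\<zeta> :: complex. \<rho> \<le> norm \<zeta> \<and> norm \<zeta> \<le> 1}"
  define L where "L = {\<zeta> \<in> A. \<zeta> + inverse \<zeta> \<in> K}"
  have A_eq: "A = cball 0 1 - ball 0 \<rho>" by (auto simp: A_def)
  have "compact A" unfolding A_eq by (intro compact_diff) auto
  moreover have "continuous_on A (\<lambda>\<zeta>. \<zeta> + inverse \<zeta>)"
    using assms(1) by (auto simp: A_def intro!: continuous_intros)
  then have "closedin (top_of_set A) (A \<inter> (\<lambda>\<zeta>. \<zeta> + inverse \<zeta>) -` K)"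
    using assms(3) by (intro continuous_closedin_preimage compact_imp_closed)
  ultimately have "compact L"
    using closedin_compact[of A L] by (simp add: L_def Int_def vimage_def)
  have in_L: "\<rho> < norm \<zeta> \<and> \<zeta> \<in> L"
    if "\<zeta> \<noteq> 0" "norm \<zeta> \<le> 1" "\<zeta> + inverse \<zeta> \<in> K" for \<zeta>
  proof -
    have "\<rho> < norm \<zeta>"
      using joukowski_notin_Omega[OF assms(1,2) that(1)] that(3) assms(4) by force
    then show ?thesis using that by (auto simp: L_def A_def)
  qed
  show thesis
  proof (cases "L = {}")
    \<comment> \<open>Without preimages the bound is vacuous, so any admissible value such as 1 will
      do.\<close>
    case True
    with in_L show thesis using that[of 1] assms(2) by auto
  next
    case False
    obtain \<zeta>0 where \<zeta>0: "\<zeta>0 \<in> L" "\<And>\<zeta>. \<zeta> \<in> L \<Longrightarrow> norm \<zeta>0 \<le> norm \<zeta>"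
      using continuous_attains_inf[OF \<open>compact L\<close> False continuous_on_norm_id] by auto
    then have "\<zeta>0 \<noteq> 0" "norm \<zeta>0 \<le> 1" "\<zeta>0 + inverse \<zeta>0 \<in> K"
      using assms(1) by (auto simp: L_def A_def)
    then show thesis using in_L \<zeta>0 that[of "norm \<zeta>0"] by auto
  qed
qed

section \<open>Growth and generating function of the polynomials\<close>

text \<open>Each step multiplies by \<open>inverse \<zeta>\<close> and adds an error of norm at most
  2, itself at most \<open>2 * inverse (norm \<zeta>) ^ Suc r\<close>; the factor
  \<open>Suc r\<close> counts these errors. The bound remains valid at \<open>\<zeta> = 1\<close>
  and \<open>\<zeta> = -1\<close>, where the two roots coincide.\<close>

lemma norm_Xpol_joukowski_le:
  assumes "\<zeta> \<noteq> 0" "norm \<zeta> \<le> 1" "norm (qinv q) \<le> 1"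
  shows "norm (Xpol r q (\<zeta> + inverse \<zeta>)) \<le> 2 * real (Suc r) * inverse (norm \<zeta>) ^ r"
proof -
  define X where "X r = Xpol r q (\<zeta> + inverse \<zeta>)" for r
  \<comment> \<open>For \<open>r \<ge> 1\<close> the recursion factors: these differences form a geometric sequence of ratio \<open>\<zeta>\<close>.\<close>
  have step: "norm (X (Suc r) - inverse \<zeta> * X r) \<le> 2" for r
  proof (induction r)
    case 0
    then show ?case using assms(2) by (simp add: X_def Xpol_rec)
  next
    case (Suc r)
    show ?case
    proof (cases "r = 0")
      case True
      \<comment> \<open>The term \<open>qinv q\<close> enters the recursion only at this index;
        bounding both summands by 1 is the source of the constant 2.\<close>
      have "X (Suc (Suc 0)) - inverse \<zeta> * X (Suc 0) = \<zeta>\<^sup>2 - qinv q"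
        using assms(1) by (simp add: X_def Xpol_rec field_simps power2_eq_square)
      moreover have "norm (\<zeta>\<^sup>2 - qinv q) \<le> norm (\<zeta>\<^sup>2) + norm (qinv q)"
        by (rule norm_triangle_ineq4)
      ultimately show ?thesis using True assms(2,3)
        by (smt (verit) norm_power power_le_one norm_ge_zero)
    next
      case False
      then have "X (Suc (Suc r)) - inverse \<zeta> * X (Suc r) = \<zeta> * (X (Suc r) - inverse \<zeta> * X r)"
        using assms(1) by (simp add: X_def Xpol_rec algebra_simps)
      then have "norm (X (Suc (Suc r)) - inverse \<zeta> * X (Suc r)) \<le>
          1 * norm (X (Suc r) - inverse \<zeta> * X r)"
        by (simp add: norm_mult mult_left_le_one_le assms(2))
      with Suc show ?thesis by simp
    qed
  qed
  have inv: "1 \<le> inverse (norm \<zeta>)"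
    using assms(1,2) by (simp add: one_le_inverse)
  have "norm (X r) \<le> 2 * real (Suc r) * inverse (norm \<zeta>) ^ r"
  proof (induction r)
    case 0
    then show ?case by (simp add: X_def Xpol_rec)
  next
    case (Suc r)
    have "norm (X (Suc r)) \<le> norm (inverse \<zeta> * X r) + norm (X (Suc r) - inverse \<zeta> * X r)"
      by (rule norm_triangle_sub)
    also have "\<dots> \<le> inverse (norm \<zeta>) * (2 * real (Suc r) * inverse (norm \<zeta>) ^ r) +
        2 * inverse (norm \<zeta>) ^ Suc r"
    proof (intro add_mono)
      show "norm (inverse \<zeta> * X r) \<le> inverse (norm \<zeta>) * (2 * real (Suc r) * inverse (norm \<zeta>) ^ r)"
        unfolding norm_mult norm_inverse by (intro mult_left_mono Suc) auto
      show "norm (X (Suc r) - inverse \<zeta> * X r) \<le> 2 * inverse (norm \<zeta>) ^ Suc r"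
        using step[of r] one_le_power[OF inv, of "Suc r"] by linarith
    qed
    also have "\<dots> = 2 * real (Suc (Suc r)) * inverse (norm \<zeta>) ^ Suc r"
      by (simp add: algebra_simps)
    finally show ?case .
  qed
  then show ?thesis by (simp add: X_def)
qed

lemma summable_Suc_times_power:
  fixes x :: real
  assumes "0 \<le> x" "x < 1"
  shows "summable (\<lambda>r. real (Suc r) * x ^ r)"
  using sums_summable[OF geometric_deriv_sums[of x]] assms by simp

text \<open>Multiplying the recursion by \<open>t ^ Suc (Suc r)\<close> and summing gives the
  identity wherever the series converges. The product form does not presuppose that the quadratic is
  nonzero; this is deduced from it later.\<close>

lemma suminf_Xpol:
  assumes "summable (\<lambda>r. Xpol r q z * t ^ r)"
  shows "(1 - z * t + t\<^sup>2) * (\<Sum>r. Xpol r q z * t ^ r) = 1 - qinv q * t\<^sup>2"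
proof -
  define S where "S = (\<Sum>r. Xpol r q z * t ^ r)"
  note sums0 = summable_sums[OF assms, folded S_def]
  then have sums1: "(\<lambda>r. Xpol (Suc r) q z * t ^ Suc r) sums (S - 1)"
    by (subst sums_Suc_iff) (simp add: Xpol_rec)
  then have sums2: "(\<lambda>r. Xpol (Suc (Suc r)) q z * t ^ Suc (Suc r)) sums (S - 1 - z * t)"
    by (subst sums_Suc_iff[of "\<lambda>r. Xpol (Suc r) q z * t ^ Suc r"]) (simp add: Xpol_rec)
  have "(\<lambda>r. z * t * (Xpol (Suc r) q z * t ^ Suc r) - t\<^sup>2 * (Xpol r q z * t ^ r)
      - (if r = 0 then qinv q * t\<^sup>2 else 0)) sums (z * t * (S - 1) - t\<^sup>2 * S - qinv q * t\<^sup>2)"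
    by (intro sums_diff sums_mult sums0 sums1 sums_single)
  moreover have "z * t * (Xpol (Suc r) q z * t ^ Suc r) - t\<^sup>2 * (Xpol r q z * t ^ r)
      - (if r = 0 then qinv q * t\<^sup>2 else 0) = Xpol (Suc (Suc r)) q z * t ^ Suc (Suc r)" for r
    by (simp add: Xpol_rec algebra_simps power2_eq_square)
  ultimately have "S - 1 - z * t = z * t * (S - 1) - t\<^sup>2 * S - qinv q * t\<^sup>2"
    using sums2 sums_unique2 by force
  then show ?thesis unfolding S_def[symmetric] by (simp add: algebra_simps)
qed

section \<open>The coefficients as integrals over a smaller circle\<close>

text \<open>Distinguishes whether \<open>1 - qinv q * \<xi>\<^sup>2\<close> has its zeros on the
  unit circle or has none in the closed disc.\<close>

lemma qinv_cases:
  assumes "q \<ge> 1"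
  shows "qinv q = 1 \<or> norm (qinv q) < 1"
proof (cases q)
  case (enat n)
  with assms have "n \<ge> 1" by (simp add: one_enat_def)
  then show ?thesis using enat by (cases "n = 1") (auto simp: qinv_def norm_divide)
qed (simp add: qinv_def)

text \<open>The radial homotopy between the circles stays within the closed annulus, hence in
  \<open>S\<close>.\<close>

lemma contour_integral_circlepath_annulus_eq:
  assumes "F holomorphic_on S" "open S" "0 < s" "s \<le> 1"
    and "\<And>\<xi>. s \<le> norm \<xi> \<Longrightarrow> norm \<xi> \<le> 1 \<Longrightarrow> \<xi> \<in> S"
  shows "contour_integral (circlepath 0 s) F = contour_integral (circlepath 0 1) F"
proof (rule Cauchy_theorem_homotopic_loops[OF _ assms(2,1)])
  show "homotopic_loops S (circlepath 0 s) (circlepath 0 1)"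
  proof (rule homotopic_loops_linear)
    fix t :: real
    define e where "e = exp (2 * of_real pi * \<i> * of_real t)"
    have e: "norm e = 1" by (simp add: e_def)
    show "closed_segment (circlepath 0 s t) (circlepath 0 1 t) \<subseteq> S"
    proof
      fix x assume "x \<in> closed_segment (circlepath 0 s t) (circlepath 0 1 t)"
      then obtain u where u: "0 \<le> u" "u \<le> 1" and x: "x = ((1 - u) * s + u) *\<^sub>R e"
        by (auto simp: closed_segment_def circlepath e_def scaleR_conv_of_real algebra_simps)
      have "norm x = (1 - u) * s + u"
        using u assms(3) by (simp add: x e)
      also have "\<dots> = s + u * (1 - s)" by (simp add: algebra_simps)
      finally have "norm x = s + u * (1 - s)" .
      moreover have "0 \<le> u * (1 - s)" "u * (1 - s) \<le> 1 - s"
        using u assms(4) by (auto simp: mult_left_le_one_le)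
      ultimately show "x \<in> S" by (intro assms(5)) linarith+
    qed
  qed auto
qed auto

definition coeff_integrand :: "nat \<Rightarrow> enat \<Rightarrow> (complex \<Rightarrow> complex) \<Rightarrow> complex \<Rightarrow> complex" where
  "coeff_integrand r q h \<xi> =
     h (\<xi> + inverse \<xi>) * \<xi> powi (int r - 1) * ((1 - \<xi>\<^sup>2) / (1 - qinv q * \<xi>\<^sup>2))"

context
  fixes \<rho> s :: real and h :: "complex \<Rightarrow> complex" and q :: enat
  assumes \<rho>: "0 < \<rho>" "\<rho> < s" "s < 1"
    and h: "h holomorphic_on Omega \<rho>"
    and q: "q \<ge> 1"
begin

lemma joukowski_circle_in_Omega: "norm \<xi> = s \<Longrightarrow> \<xi> + inverse \<xi> \<in> Omega \<rho>"
  using \<rho> one_less_inverse[of \<rho>] by (intro joukowski_in_Omega) auto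

lemma holomorphic_joukowski:
  assumes "\<And>\<xi>. \<xi> \<in> S \<Longrightarrow> \<rho> < norm \<xi> \<and> norm \<xi> < inverse \<rho>"
  shows "(\<lambda>\<xi>. h (\<xi> + inverse \<xi>)) holomorphic_on S"
proof -
  have "(\<lambda>\<xi>. \<xi> + inverse \<xi>) ` S \<subseteq> Omega \<rho>"
    using joukowski_in_Omega[of \<rho>] assms \<rho> by auto
  moreover have "(\<lambda>\<xi>. \<xi> + inverse \<xi>) holomorphic_on S"
    using assms \<rho> by (force intro!: holomorphic_intros)
  ultimately show ?thesis
    using holomorphic_on_compose_gen[OF _ h] by (simp add: o_def)
qed

lemma qinv_mult_square_neq_1:
  assumes "norm \<xi> < 1"
  shows "1 - qinv q * \<xi>\<^sup>2 \<noteq> 0"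
proof
  assume "1 - qinv q * \<xi>\<^sup>2 = 0"
  then have "norm (qinv q) * (norm \<xi>)\<^sup>2 = 1"
    by (metis eq_iff_diff_eq_0 norm_mult norm_one norm_power)
  moreover have "norm (qinv q) \<le> 1" using qinv_cases[OF q] by auto
  moreover have "(norm \<xi>)\<^sup>2 < 1" using assms by (simp add: abs_square_less_1)
  ultimately show False
    by (smt (verit) mult_left_le_one_le norm_ge_zero zero_le_power2)
qed

text \<open>Moving the contour to radius \<open>s\<close> makes \<open>\<xi> ^ r\<close> contribute
  the decay \<open>s ^ r\<close>. No singularity is crossed, since the zeros of the denominator
  either cancel or lie outside the closed disc.\<close>

lemma coeff_a_eq_smaller_circle:
  "2 * of_real pi * \<i> * coeff_a r q h = contour_integral (circlepath 0 s) (coeff_integrand r q h)"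
proof -
  define U where "U = {\<xi> :: complex. \<rho> < norm \<xi> \<and> norm \<xi> < inverse \<rho>}"
  have U: "open U" unfolding U_def
    by (intro open_Collect_conj open_Collect_less continuous_intros)
  have in_U: "\<xi> \<in> U" if "s \<le> norm \<xi>" "norm \<xi> \<le> 1" for \<xi>
    using that \<rho> one_less_inverse[of \<rho>] by (auto simp: U_def)
  have "contour_integral (circlepath 0 1) (coeff_integrand r q h) =
      contour_integral (circlepath 0 s) (coeff_integrand r q h)"
    using qinv_cases[OF q]
  proof
    assume q1: "qinv q = 1"
    \<comment> \<open>The integrand takes the junk value 0 at its removable singularities 1 and -1.\<close>
    define F where "F \<xi> = h (\<xi> + inverse \<xi>) * \<xi> powi (int r - 1)" for \<xi>
    have eq: "coeff_integrand r q h \<xi> = F \<xi>" if "\<xi> \<notin> {1, -1}" for \<xi>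
      using that by (auto simp: coeff_integrand_def F_def q1 power2_eq_1_iff)
    have "F holomorphic_on U" unfolding F_def
      using \<rho> by (intro holomorphic_intros holomorphic_joukowski) (auto simp: U_def)
    then have "contour_integral (circlepath 0 s) F = contour_integral (circlepath 0 1) F"
      by (rule contour_integral_circlepath_annulus_eq[OF _ U]) (use in_U \<rho> in auto)
    \<comment> \<open>The smaller circle avoids 1 and -1; on the unit circle, a simple path, these
      finitely many points do not affect the integral.\<close>
    moreover have "contour_integral (circlepath 0 s) (coeff_integrand r q h) =
        contour_integral (circlepath 0 s) F"
      using \<rho> by (intro contour_integral_eq eq) auto
    moreover have "contour_integral (circlepath 0 1) (coeff_integrand r q h) =
        contour_integral (circlepath 0 1) F"
      by (intro contour_integral_spike_finite_simple_path[of "{1, -1}"] eq)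
        (auto simp: simple_path_circlepath)
    ultimately show ?thesis by simp
  next
    assume q1: "norm (qinv q) < 1"
    \<comment> \<open>The norm condition keeps the denominator nonzero; \<open>V\<close> is open and
      still contains the closed annulus between \<open>s\<close> and 1.\<close>
    define V where "V = U \<inter> {\<xi>. norm (qinv q * \<xi>\<^sup>2) < 1}"
    have "open V" unfolding V_def
      by (intro open_Int U open_Collect_less continuous_intros)
    moreover have "coeff_integrand r q h holomorphic_on V"
      unfolding coeff_integrand_def using \<rho>
      by (intro holomorphic_intros holomorphic_joukowski) (auto simp: U_def V_def)
    moreover have "\<xi> \<in> V" if "s \<le> norm \<xi>" "norm \<xi> \<le> 1" for \<xi>
    proof -
      have "norm (qinv q * \<xi>\<^sup>2) \<le> norm (qinv q)"
        unfolding norm_mult norm_power using that by (intro mult_right_le_one_le power_le_one) auto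
      then show ?thesis using in_U[OF that] q1 by (auto simp: V_def)
    qed
    ultimately show ?thesis
      by (intro contour_integral_circlepath_annulus_eq[symmetric, of _ V]) (use \<rho> in auto)
  qed
  moreover have "2 * of_real pi * \<i> * coeff_a r q h =
      contour_integral (circlepath 0 1) (coeff_integrand r q h)"
    unfolding coeff_a_def coeff_integrand_def[abs_def] by simp
  ultimately show ?thesis by simp
qed

lemma continuous_on_coeff_integrand: "continuous_on (sphere 0 s) (coeff_integrand r q h)"
proof -
  have "coeff_integrand r q h holomorphic_on sphere 0 s"
    unfolding coeff_integrand_def
    using \<rho> one_less_inverse[of \<rho>] qinv_mult_square_neq_1
    by (intro holomorphic_intros holomorphic_joukowski) auto
  then show ?thesis by (rule holomorphic_on_imp_continuous_on)
qed

lemma coeff_integrable: "coeff_integrand r q h contour_integrable_on circlepath 0 s"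
  using continuous_on_coeff_integrand \<rho> by (intro contour_integrable_continuous_circlepath) simp

text \<open>Since \<open>r\<close> enters only through a monomial, one bound for index 0 serves all
  indices, and the sum over \<open>r\<close> becomes a power series in \<open>\<xi>\<close>.\<close>

lemma coeff_integrand_eq:
  "\<xi> \<noteq> 0 \<Longrightarrow> coeff_integrand r q h \<xi> = coeff_integrand 0 q h \<xi> * \<xi> ^ r"
  by (simp add: coeff_integrand_def power_int_diff power_int_minus divide_inverse)

lemma coeff_bounds:
  obtains B where "B \<ge> 0"
    "\<And>r \<xi>. norm \<xi> = s \<Longrightarrow> norm (coeff_integrand r q h \<xi>) \<le> B * s ^ r"
    "\<And>r. norm (coeff_a r q h) \<le> B * s ^ r"
proof -
  have "bounded (coeff_integrand 0 q h ` sphere 0 s)"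
    by (intro compact_imp_bounded compact_continuous_image continuous_on_coeff_integrand) simp
  then obtain B where B: "B > 0" "\<And>\<xi>. norm \<xi> = s \<Longrightarrow> norm (coeff_integrand 0 q h \<xi>) \<le> B"
    by (auto simp: bounded_pos)
  have bound: "norm (coeff_integrand r q h \<xi>) \<le> B * s ^ r" if "norm \<xi> = s" for r \<xi>
  proof -
    have "\<xi> \<noteq> 0" using that \<rho> by auto
    then show ?thesis
      unfolding coeff_integrand_eq[OF \<open>\<xi> \<noteq> 0\<close>, of r] norm_mult norm_power that
      using B(2)[OF that] \<rho> by (intro mult_right_mono) auto
  qed
  have "norm (coeff_a r q h) \<le> B * s ^ r" for r
  proof -
    have "norm (2 * of_real pi * \<i> * coeff_a r q h) \<le> B * s ^ r * (2 * pi * s)"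
      unfolding coeff_a_eq_smaller_circle using \<rho> B(1)
      by (intro has_contour_integral_bound_circlepath[OF
            has_contour_integral_integral[OF coeff_integrable]] bound) auto
    then have "norm (coeff_a r q h) \<le> B * s ^ r * s"
      by (simp add: norm_mult)
    \<comment> \<open>The spare factor \<open>s < 1\<close> comes from the length
      \<open>2 * pi * s\<close> of the circle.\<close>
    also have "\<dots> \<le> B * s ^ r"
      using \<rho> B(1) by (intro mult_right_le_one_le) auto
    finally show ?thesis .
  qed
  with B bound show thesis by (intro that[of B]) auto
qed

section \<open>Cauchy's formula on the ellipse and expansion of its kernel\<close>

text \<open>Cauchy's formula over the image of the circle is pulled back by
  \<open>w = \<xi> + inverse \<xi>\<close>. The winding number -1 cancels the sign of
  \<open>\<xi>\<^sup>2 - 1\<close> coming from the derivative.\<close>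

lemma Cauchy_joukowski:
  assumes "s < norm \<zeta>" "norm \<zeta> \<le> 1" and z: "z = \<zeta> + inverse \<zeta>" "z \<in> Omega \<rho>"
  shows "contour_integral (circlepath 0 s)
    (\<lambda>\<xi>. h (\<xi> + inverse \<xi>) * inverse \<xi> * (1 - \<xi>\<^sup>2) / (1 - z * \<xi> + \<xi>\<^sup>2)) = 2 * of_real pi * \<i> * h z"
proof -
  define J where "J \<xi> = \<xi> + inverse \<xi>" for \<xi> :: complex
  define \<gamma> where "\<gamma> = J \<circ> circlepath 0 s"
  have \<zeta>: "\<zeta> \<noteq> 0" and inv: "norm (inverse \<zeta>) \<ge> 1"
    using assms \<rho> by (auto simp: norm_inverse intro!: one_le_inverse)
  have holo: "J holomorphic_on -{0}" unfolding J_def by (intro holomorphic_intros) auto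
  then have ana: "J analytic_on -{0}" by (subst analytic_on_open) auto
  have pim: "path_image (circlepath 0 s) \<subseteq> -{0}" using \<rho> by auto
  have \<gamma>: "valid_path \<gamma>" unfolding \<gamma>_def
    by (intro valid_path_compose_analytic[OF _ ana] pim) auto
  have deriv: "deriv J \<xi> = 1 - inverse (\<xi>\<^sup>2)" if "\<xi> \<noteq> 0" for \<xi>
    unfolding J_def
    by (rule DERIV_imp_deriv) (use that in \<open>auto intro!: derivative_eq_intros simp: power2_eq_square\<close>)
  have factor: "1 - z * \<xi> + \<xi>\<^sup>2 = (\<xi> - \<zeta>) * (\<xi> - inverse \<zeta>)" for \<xi>
    using \<zeta> by (simp add: z(1) algebra_simps power2_eq_square)
  have J_diff: "J \<xi> - z = (\<xi> - \<zeta>) * (\<xi> - inverse \<zeta>) / \<xi>" if "\<xi> \<noteq> 0" for \<xi>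
    using that factor[of \<xi>] by (simp add: J_def field_simps power2_eq_square)
  \<comment> \<open>Both roots lie strictly outside the circle, as \<open>s < norm \<zeta>\<close>
    and \<open>norm (inverse \<zeta>) \<ge> 1\<close>.\<close>
  have nz: "\<xi> \<noteq> 0" "\<xi> \<noteq> \<zeta>" "\<xi> \<noteq> inverse \<zeta>" if "norm \<xi> = s" for \<xi>
    using that inv assms(1) \<rho> by auto
  have z_notin: "z \<notin> path_image \<gamma>"
  proof
    assume "z \<in> path_image \<gamma>"
    then obtain \<xi> where "norm \<xi> = s" "J \<xi> - z = 0"
      using \<rho> by (auto simp: \<gamma>_def path_image_compose)
    with nz J_diff show False by auto
  qed
  have "winding_number \<gamma> z = -1"
  proof -
    \<comment> \<open>Logarithmic derivative of \<open>J \<xi> - z = (\<xi> - \<zeta>)(\<xi> - 1/\<zeta>)/\<xi>\<close>: only the pole at 0 is inside the circle.\<close>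
    have int: "((\<lambda>\<xi>. 1 / (\<xi> - a)) has_contour_integral 0) (circlepath 0 s)"
      if "s < norm a" for a :: complex
      using \<rho> that by (intro Cauchy_theorem_disc_simple[of _ 0 "norm a"] holomorphic_intros) auto
    have "((\<lambda>\<xi>. 1 / (\<xi> - \<zeta>) + 1 / (\<xi> - inverse \<zeta>) - 1 / (\<xi> - 0))
        has_contour_integral 0 + 0 - 2 * of_real pi * \<i> * 1) (circlepath 0 s)"
      using \<rho> assms(1) inv
      by (intro has_contour_integral_diff has_contour_integral_add int
          Cauchy_integral_circlepath_simple) auto
    then have "- (2 * of_real pi * \<i>) = contour_integral (circlepath 0 s)
        (\<lambda>\<xi>. 1 / (\<xi> - \<zeta>) + 1 / (\<xi> - inverse \<zeta>) - 1 / (\<xi> - 0))"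
      by (simp add: contour_integral_unique)
    also have "\<dots> = contour_integral (circlepath 0 s) (\<lambda>\<xi>. deriv J \<xi> * (1 / (J \<xi> - z)))"
    proof (rule contour_integral_eq)
      fix \<xi> assume "\<xi> \<in> path_image (circlepath 0 s)"
      with \<rho> have \<xi>: "norm \<xi> = s" by simp
      note nz = nz[OF this]
      show "1 / (\<xi> - \<zeta>) + 1 / (\<xi> - inverse \<zeta>) - 1 / (\<xi> - 0) = deriv J \<xi> * (1 / (J \<xi> - z))"
        unfolding deriv[OF nz(1)] J_diff[OF nz(1)] using nz \<zeta>
        by (simp add: divide_simps) (simp add: algebra_simps power2_eq_square)
    qed
    also have "\<dots> = contour_integral \<gamma> (\<lambda>w. 1 / (w - z))"
      unfolding \<gamma>_def by (rule contour_integral_comp_analyticW[OF ana _ pim, symmetric]) auto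
    finally have "contour_integral \<gamma> (\<lambda>w. 1 / (w - z)) = - (2 * of_real pi * \<i>)" ..
    then show ?thesis
      by (simp add: winding_number_valid_path[OF \<gamma> z_notin])
  qed
  \<comment> \<open>Convexity of the ellipse gives the formula for any closed valid path in it
    avoiding \<open>z\<close>, weighted by the winding number.\<close>
  moreover have "((\<lambda>w. h w / (w - z)) has_contour_integral 2 * pi * \<i> * winding_number \<gamma> z * h z) \<gamma>"
  proof (rule Cauchy_integral_formula_convex_simple[OF convex_Omega h])
    show "path_image \<gamma> \<subseteq> Omega \<rho> - {z}"
      using z_notin \<rho> joukowski_circle_in_Omega by (auto simp: \<gamma>_def path_image_compose J_def)
    show "pathfinish \<gamma> = pathstart \<gamma>"
      by (simp add: \<gamma>_def pathfinish_compose pathstart_compose)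
  qed (use z \<gamma> open_Omega in \<open>auto simp: interior_open\<close>)
  ultimately have "- (2 * of_real pi * \<i> * h z) = contour_integral \<gamma> (\<lambda>w. h w / (w - z))"
    by (simp add: contour_integral_unique)
  also have "\<dots> = contour_integral (circlepath 0 s) (\<lambda>\<xi>. deriv J \<xi> * (h (J \<xi>) / (J \<xi> - z)))"
    unfolding \<gamma>_def by (rule contour_integral_comp_analyticW[OF ana _ pim]) auto
  also have "\<dots> = contour_integral (circlepath 0 s)
      (\<lambda>\<xi>. - (h (\<xi> + inverse \<xi>) * inverse \<xi> * (1 - \<xi>\<^sup>2) / (1 - z * \<xi> + \<xi>\<^sup>2)))"
  proof (rule contour_integral_eq)
    fix \<xi> assume "\<xi> \<in> path_image (circlepath 0 s)"
    with \<rho> have \<xi>: "norm \<xi> = s" by simp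
    note nz = nz[OF this]
    show "deriv J \<xi> * (h (J \<xi>) / (J \<xi> - z)) =
      - (h (\<xi> + inverse \<xi>) * inverse \<xi> * (1 - \<xi>\<^sup>2) / (1 - z * \<xi> + \<xi>\<^sup>2))"
      unfolding deriv[OF nz(1)] J_diff[OF nz(1)] factor J_def[symmetric] using nz
      by (simp add: divide_simps) (simp add: algebra_simps power2_eq_square)
  qed
  finally show ?thesis by (simp add: contour_integral_neg)
qed

text \<open>Sum and integral may be exchanged because on the circle the terms are dominated by a
  multiple of \<open>real (Suc r) * (s / norm \<zeta>) ^ r\<close>, with ratio below 1.\<close>

lemma coeff_a_Xpol_sums:
  assumes "s < norm \<zeta>" "norm \<zeta> \<le> 1" and z: "z = \<zeta> + inverse \<zeta>" "z \<in> Omega \<rho>"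
  shows "(\<lambda>r. coeff_a r q h * Xpol r q z) sums h z"
proof -
  obtain B where B: "B \<ge> 0"
    "\<And>r \<xi>. norm \<xi> = s \<Longrightarrow> norm (coeff_integrand r q h \<xi>) \<le> B * s ^ r"
    using coeff_bounds by metis
  have \<zeta>: "\<zeta> \<noteq> 0" using assms \<rho> by auto
  have q1: "norm (qinv q) \<le> 1" using qinv_cases[OF q] by auto
  define M where "M r = real (Suc r) * (s / norm \<zeta>) ^ r" for r
  have M: "summable M" unfolding M_def
    using assms(1) \<rho> by (intro summable_Suc_times_power) (auto simp: divide_less_eq)
  have X: "norm (Xpol r q z) * s ^ r \<le> 2 * M r" for r
    using mult_right_mono[OF norm_Xpol_joukowski_le[OF \<zeta> assms(2) q1, of r], of "s ^ r"] \<rho>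
    by (simp add: M_def z(1) power_divide field_simps)
  have summ: "summable (\<lambda>r. Xpol r q z * \<xi> ^ r)" if "norm \<xi> = s" for \<xi>
    using X by (intro summable_comparison_test'[OF summable_mult[OF M, of 2]])
      (simp add: norm_mult norm_power that)
  define f where "f r \<xi> = coeff_integrand r q h \<xi> * Xpol r q z" for r \<xi>
  have f_int: "f r contour_integrable_on circlepath 0 s" for r
    unfolding f_def by (intro contour_integrable_rmul coeff_integrable)
  have f_contour: "contour_integral (circlepath 0 s) (f r) =
      2 * of_real pi * \<i> * (coeff_a r q h * Xpol r q z)" for r
    unfolding f_def contour_integral_rmul[OF coeff_integrable]
      coeff_a_eq_smaller_circle[symmetric] by (simp only: mult.assoc)
  have lim: "uniform_limit (sphere 0 s) (\<lambda>n \<xi>. \<Sum>r<n. f r \<xi>) (\<lambda>\<xi>. \<Sum>r. f r \<xi>) sequentially"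
  proof (rule Weierstrass_m_test)
    fix r \<xi> assume "\<xi> \<in> sphere (0 :: complex) s"
    then have "norm (f r \<xi>) \<le> B * s ^ r * norm (Xpol r q z)"
      unfolding f_def norm_mult by (intro mult_right_mono B(2)) auto
    also have "\<dots> = B * (norm (Xpol r q z) * s ^ r)" by simp
    also have "\<dots> \<le> B * (2 * M r)" by (intro mult_left_mono X B(1))
    finally show "norm (f r \<xi>) \<le> B * (2 * M r)" .
  qed (intro summable_mult M)
  have ev: "\<forall>\<^sub>F n in sequentially. (\<lambda>\<xi>. \<Sum>r<n. f r \<xi>) contour_integrable_on circlepath 0 s"
    by (intro always_eventually allI contour_integrable_sum f_int finite_lessThan)
  have "(\<lambda>n. contour_integral (circlepath 0 s) (\<lambda>\<xi>. \<Sum>r<n. f r \<xi>))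
      \<longlonglongrightarrow> contour_integral (circlepath 0 s) (\<lambda>\<xi>. \<Sum>r. f r \<xi>)"
    by (rule contour_integral_uniform_limit_circlepath(2)[OF ev lim]) (use \<rho> in auto)
  also have "contour_integral (circlepath 0 s) (\<lambda>\<xi>. \<Sum>r. f r \<xi>) = contour_integral (circlepath 0 s)
      (\<lambda>\<xi>. h (\<xi> + inverse \<xi>) * inverse \<xi> * (1 - \<xi>\<^sup>2) / (1 - z * \<xi> + \<xi>\<^sup>2))"
  proof (rule contour_integral_eq)
    fix \<xi> assume "\<xi> \<in> path_image (circlepath 0 s)"
    with \<rho> have \<xi>: "norm \<xi> = s" "\<xi> \<noteq> 0" by auto
    have "f r \<xi> = coeff_integrand 0 q h \<xi> * (Xpol r q z * \<xi> ^ r)" for r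
      unfolding f_def by (subst coeff_integrand_eq[OF \<xi>(2)]) (simp only: mult_ac)
    then have "(\<Sum>r. f r \<xi>) = (\<Sum>r. coeff_integrand 0 q h \<xi> * (Xpol r q z * \<xi> ^ r))"
      by simp
    also have "\<dots> = coeff_integrand 0 q h \<xi> * (\<Sum>r. Xpol r q z * \<xi> ^ r)"
      by (rule suminf_mult[OF summ[OF \<xi>(1)]])
    finally have *: "(\<Sum>r. f r \<xi>) = coeff_integrand 0 q h \<xi> * (\<Sum>r. Xpol r q z * \<xi> ^ r)" .
    have "1 - qinv q * \<xi>\<^sup>2 \<noteq> 0"
      using \<xi> \<rho> by (intro qinv_mult_square_neq_1) auto
    moreover note suminf_Xpol[OF summ[OF \<xi>(1)]]
    \<comment> \<open>The quadratic divides the nonzero right-hand side of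
      \<open>suminf_Xpol\<close>, so it cannot vanish.\<close>
    moreover from calculation have "1 - z * \<xi> + \<xi>\<^sup>2 \<noteq> 0" by auto
    ultimately have "(\<Sum>r. Xpol r q z * \<xi> ^ r) = (1 - qinv q * \<xi>\<^sup>2) / (1 - z * \<xi> + \<xi>\<^sup>2)"
      by (simp add: eq_divide_eq mult.commute)
    \<comment> \<open>The numerator of the generating function cancels the denominator of the
      integrand, so the kernel no longer depends on \<open>q\<close>.\<close>
    with \<open>1 - qinv q * \<xi>\<^sup>2 \<noteq> 0\<close>
    show "(\<Sum>r. f r \<xi>) = h (\<xi> + inverse \<xi>) * inverse \<xi> * (1 - \<xi>\<^sup>2) / (1 - z * \<xi> + \<xi>\<^sup>2)"
      unfolding * by (simp add: coeff_integrand_def power_int_minus)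
  qed
  also have "\<dots> = 2 * of_real pi * \<i> * h z"
    by (rule Cauchy_joukowski[OF assms])
  also have "(\<lambda>n. contour_integral (circlepath 0 s) (\<lambda>\<xi>. \<Sum>r<n. f r \<xi>)) =
      (\<lambda>n. \<Sum>r<n. 2 * of_real pi * \<i> * (coeff_a r q h * Xpol r q z))"
    by (subst contour_integral_sum) (simp_all only: f_int f_contour finite_lessThan)
  finally have "(\<lambda>r. 2 * of_real pi * \<i> * (coeff_a r q h * Xpol r q z)) sums (2 * of_real pi * \<i> * h z)"
    unfolding sums_def .
  then show ?thesis by (rule sums_mult_iff[THEN iffD1, rotated]) simp
qed

end

section \<open>Absolute and uniform convergence on compact sets\<close>

theorem theorem4p1:
  fixes \<rho> :: real and h :: "complex \<Rightarrow> complex"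
  assumes "\<rho> > 0" and "\<rho> \<noteq> 1"
    and "h holomorphic_on Omega \<rho>"
  shows "\<forall>q :: enat. q \<ge> 1 \<longrightarrow>
    (\<forall>z \<in> Omega \<rho>. (\<lambda>r. coeff_a r q h * Xpol r q z) sums h z) \<and>
    (\<forall>K. compact K \<and> K \<subseteq> Omega \<rho> \<longrightarrow>
      (\<forall>z \<in> K. summable (\<lambda>r. norm (coeff_a r q h * Xpol r q z))) \<and>
      uniform_limit K (\<lambda>n z. \<Sum>r<n. coeff_a r q h * Xpol r q z) h sequentially)"
proof (intro allI impI)
  fix q :: enat assume q: "q \<ge> 1"
  \<comment> \<open>Either \<open>\<rho>\<close> or its inverse is below 1, and both give the same
    ellipse.\<close>
  obtain \<sigma> where \<sigma>: "0 < \<sigma>" "\<sigma> < 1" "Omega \<sigma> = Omega \<rho>"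
  proof (cases "\<rho> < 1")
    case False
    then show thesis using assms(1,2) that[of "inverse \<rho>"]
      by (simp add: Omega_inverse inverse_less_1_iff)
  qed (use assms(1) that in auto)
  have h: "h holomorphic_on Omega \<sigma>" using assms(3) \<sigma> by simp
  have q1: "norm (qinv q) \<le> 1" using qinv_cases[OF q] by auto
  have main: "(\<forall>z \<in> K. (\<lambda>r. coeff_a r q h * Xpol r q z) sums h z) \<and>
      (\<forall>z \<in> K. summable (\<lambda>r. norm (coeff_a r q h * Xpol r q z))) \<and>
      uniform_limit K (\<lambda>n z. \<Sum>r<n. coeff_a r q h * Xpol r q z) h sequentially"
    if K: "compact K" "K \<subseteq> Omega \<sigma>" for K
  proof -
    obtain m where m: "\<sigma> < m" "m \<le> 1"
      "\<And>\<zeta>. \<zeta> \<noteq> 0 \<Longrightarrow> norm \<zeta> \<le> 1 \<Longrightarrow> \<zeta> + inverse \<zeta> \<in> K \<Longrightarrow> m \<le> norm \<zeta>"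
      using compact_joukowski_bound[OF \<sigma>(1,2) K] by metis
    \<comment> \<open>A single radius below \<open>m\<close> works for every point of
      \<open>K\<close>, so that \<open>B\<close> and the ratio \<open>s / m < 1\<close> do not
      depend on the point.\<close>
    obtain s where s: "\<sigma> < s" "s < m" using dense[OF m(1)] by auto
    then have "s < 1" using m by simp
    note ctxt = \<sigma>(1) s(1) \<open>s < 1\<close> h q
    obtain B where B: "B \<ge> 0" "\<And>r. norm (coeff_a r q h) \<le> B * s ^ r"
      using coeff_bounds[OF ctxt] by metis
    define M where "M r = B * 2 * (real (Suc r) * (s / m) ^ r)" for r
    have M: "summable M" unfolding M_def
      using s \<sigma>(1) by (intro summable_mult summable_Suc_times_power) auto
    have bound: "norm (coeff_a r q h * Xpol r q z) \<le> M r"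
      and sums: "(\<lambda>r. coeff_a r q h * Xpol r q z) sums h z" if "z \<in> K" for z r
    proof -
      obtain \<zeta> where \<zeta>: "\<zeta> \<noteq> 0" "norm \<zeta> \<le> 1" "z = \<zeta> + inverse \<zeta>"
        by (rule obtain_joukowski_preimage)
      have m\<zeta>: "m \<le> norm \<zeta>" using m(3) \<zeta> that by simp
      then show "(\<lambda>r. coeff_a r q h * Xpol r q z) sums h z"
        using coeff_a_Xpol_sums[OF ctxt _ \<zeta>(2,3)] s that K(2) by auto
      have "norm (Xpol r q z) \<le> 2 * real (Suc r) * inverse (norm \<zeta>) ^ r"
        unfolding \<zeta>(3) by (rule norm_Xpol_joukowski_le[OF \<zeta>(1,2) q1])
      also have "\<dots> \<le> 2 * real (Suc r) * inverse m ^ r"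
        using m\<zeta> m \<sigma>(1) by (intro mult_left_mono power_mono le_imp_inverse_le) auto
      finally have "norm (coeff_a r q h * Xpol r q z) \<le> B * s ^ r * (2 * real (Suc r) * inverse m ^ r)"
        unfolding norm_mult using B s \<sigma>(1) by (intro mult_mono) auto
      also have "\<dots> = M r" by (simp add: M_def power_mult_distrib divide_inverse)
      finally show "norm (coeff_a r q h * Xpol r q z) \<le> M r" .
    qed
    have "uniform_limit K (\<lambda>n z. \<Sum>r<n. coeff_a r q h * Xpol r q z)
        (\<lambda>z. \<Sum>r. coeff_a r q h * Xpol r q z) sequentially"
      by (rule Weierstrass_m_test[OF bound M])
    moreover have "(\<Sum>r. coeff_a r q h * Xpol r q z) = h z" if "z \<in> K" for z
      using sums[OF that] by (rule sums_unique[symmetric])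
    ultimately have "uniform_limit K (\<lambda>n z. \<Sum>r<n. coeff_a r q h * Xpol r q z) h sequentially"
      by (simp cong: uniform_limit_cong')
    moreover have "summable (\<lambda>r. norm (coeff_a r q h * Xpol r q z))" if "z \<in> K" for z
      using bound[OF that] by (intro summable_comparison_test'[OF M]) auto
    ultimately show ?thesis using sums by blast
  qed
  \<comment> \<open>The pointwise expansion is the case of a singleton compact set.\<close>
  have "(\<lambda>r. coeff_a r q h * Xpol r q z) sums h z" if "z \<in> Omega \<rho>" for z
    using main[of "{z}"] that \<sigma>(3) by simp
  then show "(\<forall>z \<in> Omega \<rho>. (\<lambda>r. coeff_a r q h * Xpol r q z) sums h z) \<and>
    (\<forall>K. compact K \<and> K \<subseteq> Omega \<rho> \<longrightarrow>
      (\<forall>z \<in> K. summable (\<lambda>r. norm (coeff_a r q h * Xpol r q z))) \<and>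
      uniform_limit K (\<lambda>n z. \<Sum>r<n. coeff_a r q h * Xpol r q z) h sequentially)"
    using main \<sigma>(3) by blast
qed

end
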